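(* Let $c,d_2\in\mathbb{R}\langle\langle X\rangle\rangle$ and let $d_1\in\mathbb{R}\langle\langle X\rangle\rangle$ have constant coefficient $d_1(\mathbf 1)=1$. Then $$\left(\left(\left(c\,@\begin{bmatrix}1\\ d_2\end{bmatrix}\right)@\begin{bmatrix}d_1\\ 0\end{bmatrix}\right)@\begin{bmatrix}1\\ -d_2\end{bmatrix}\right)@\begin{bmatrix}d_1^{\sqcup\!\sqcup-1}\\ 0\end{bmatrix} = c\,@\begin{bmatrix}1\\ d_2\sqcup\!\sqcup(1-d_1)\end{bmatrix}.$$
   Context: Let $X=\{x_0,x_1\}$ be an alphabet of two non-commuting letters, $X^*$ the set of words in $X$ (including the empty word, written $\emptyset$ or $\mathbf{1}$), and $\mathbb{R}\langle\langle X\rangle\rangle$ the space of formal power series $c=\sum_{\eta\in X^*}c(\eta)\eta$ with $c(\eta)\in\mathbb{R}$. Juxtaposition of a letter and a series denotes left concatenation. The symbol $\sqcup\!\sqcup$ denotes the usual shuffle product on $\mathbb{R}\langle\langle X\rangle\rangle$ (dual to the coproduct for which the letters are primitive), with unit $\emptyset$, also written $1$; $c(\mathbf 1)$ is the constant coefficient of $c$. If $c(\mathbf{1})=1$, then $c^{\sqcup\!\sqcup-1}=\sum_{k\ge0}(1-c)^{\sqcup\!\sqcup k}$ is the shuffle inverse of $c$. The composition product of $c,d\in\mathbb{R}\langle\langle X\rangle\rangle$ is $c\circ d=\sum_{\eta\in X^*}c(\eta)\,(\eta\circ d)$, where for words $\eta\in X^*$, inductively, $$\emptyset\circ d=\emptyset,\quad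 (x_0\eta)\circ d=x_0(\eta\circ d),\quad (x_1\eta)\circ d=x_0\big(d\sqcup\!\sqcup(\eta\circ d)\big).$$ Let $G=\{\mathbf{c}=[c_1\;\;c_2]^t\in\mathbb{R}\langle\langle X\rangle\rangle^2: c_1(\mathbf{1})=1\}$ and $\mathbf{e}=[1\;\;0]^t$. For $c\in\mathbb{R}\langle\langle X\rangle\rangle$ and $\mathbf{d}=[d_1\;\;d_2]^t\in G$, the mixed composition product is $c\,\tilde{\circ}\,\mathbf{d}=\sum_{\eta\in X^*}c(\eta)(\eta\,\tilde{\circ}\,\mathbf{d})$, where inductively $$\emptyset\,\tilde{\circ}\,\mathbf{d}=\emptyset,\quad (x_0\eta)\,\tilde{\circ}\,\mathbf{d}=x_0(\eta\,\tilde{\circ}\,\mathbf{d}),\quad (x_1\eta)\,\tilde{\circ}\,\mathbf{d}=x_1\big(d_1\sqcup\!\sqcup(\eta\,\tilde{\circ}\,\mathbf{d})\big)+x_0\big(d_2\sqcup\!\sqcup(\eta\,\tilde{\circ}\,\mathbf{d})\big).$$ Componentwise: $\mathbf{d}\,\bar{\circ}\,c=[d_1\circ c\;\;\;d_2\circ c]^t$ and $\mathbf{c}\triangleleft\mathbf{d}=[c_1\,\tilde{\circ}\,\mathbf{d}\;\;\;c_2\,\tilde{\circ}\,\mathbf{d}]^t$, both in $G$. On $G$ define two products $$\mathbf{c}\odot\mathbf{d}=[\,c_1\sqcup\!\sqcup d_1\;\;\;c_2+(d_2\sqcup\!\sqcup c_1)\,]^t,\qquad \mathbf{c}\star\mathbf{d}=(\mathbf{c}\triangleleft\mathbf{d})\odot\mathbf{d}.$$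 It is known that $(G,\odot)$ and $(G,\star)$ are groups, both with identity $\mathbf{e}$; inverses are written $\mathbf{c}^{\odot-1}$ and $\mathbf{c}^{\star-1}$. For $c\in\mathbb{R}\langle\langle X\rangle\rangle$ and $\mathbf{d}\in G$, the affine feedback product is $$c@\mathbf{d}=c\,\tilde{\circ}\,\Big(\big(\mathbf{d}^{\odot-1}\big)\,\bar{\circ}\,c\Big)^{\star-1}\in\mathbb{R}\langle\langle X\rangle\rangle .$$ *)

theory Defs
  imports Complex_Main "HOL-Library.Function_Algebras" "HOL-Library.Groups_Big_Fun"
    "HOL-Algebra.Group"
begin

(* Addition, subtraction, negation and zero of series are the pointwise ones.  The pointwise
   product and unit of Function_Algebras play no role; the shuffle unit is sone. *)

datatype letter = X0 | X1

type_synonym series = "letter list \<Rightarrow> real"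

definition sone :: series where
  "sone w = (if w = [] then 1 else 0)"

primrec lcons :: "letter \<Rightarrow> series \<Rightarrow> series" where
  "lcons x c [] = 0"
| "lcons x c (y # w) = (if x = y then c w else 0)"

(* The coproduct that is multiplicative for concatenation and has primitive letters;
   a sum of tensors u (x) v of words is encoded as the list of its terms (u, v). *)
primrec coproduct :: "letter list \<Rightarrow> (letter list \<times> letter list) list" where
  "coproduct [] = [([], [])]"
| "coproduct (x # w) = map (\<lambda>(u, v). (x # u, v)) (coproduct w)
                       @ map (\<lambda>(u, v). (u, x # v)) (coproduct w)"

definition shuffle :: "series \<Rightarrow> series \<Rightarrow> series"  (infixl "\<amalg>" 70) where
  "c \<amalg> d = (\<lambda>w. \<Sum>(u, v)\<leftarrow>coproduct w. c u * d v)"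

(* Sum_any is 0 on families of infinite support.  The sums below are locally finite;
   see shuffle_pow_order, comp_word_order, mixed_word_order and the lemmas derived from them. *)

definition shuffle_pow :: "series \<Rightarrow> nat \<Rightarrow> series" where
  "shuffle_pow c k = ((\<lambda>s. c \<amalg> s) ^^ k) sone"

definition shuffle_inv :: "series \<Rightarrow> series" where
  "shuffle_inv c = (\<lambda>w. Sum_any (\<lambda>k. shuffle_pow (sone - c) k w))"

primrec comp_word :: "letter list \<Rightarrow> series \<Rightarrow> series" where
  "comp_word [] d = sone"
| "comp_word (x # \<eta>) d =
     (case x of
        X0 \<Rightarrow> lcons X0 (comp_word \<eta> d)
      | X1 \<Rightarrow> lcons X0 (d \<amalg> comp_word \<eta> d))"

definition comp_prod :: "series \<Rightarrow> series \<Rightarrow> series" where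
  "comp_prod c d = (\<lambda>w. Sum_any (\<lambda>\<eta>. c \<eta> * comp_word \<eta> d w))"

primrec mixed_word :: "letter list \<Rightarrow> series \<times> series \<Rightarrow> series" where
  "mixed_word [] d = sone"
| "mixed_word (x # \<eta>) d =
     (case x of
        X0 \<Rightarrow> lcons X0 (mixed_word \<eta> d)
      | X1 \<Rightarrow> lcons X1 (fst d \<amalg> mixed_word \<eta> d) + lcons X0 (snd d \<amalg> mixed_word \<eta> d))"

definition mixed_comp :: "series \<Rightarrow> series \<times> series \<Rightarrow> series" where
  "mixed_comp c d = (\<lambda>w. Sum_any (\<lambda>\<eta>. c \<eta> * mixed_word \<eta> d w))"

definition G :: "(series \<times> series) set" where
  "G = {c. fst c [] = 1}"

definition vcomp :: "series \<times> series \<Rightarrow> series \<Rightarrow> series \<times> series" where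
  "vcomp d c = (comp_prod (fst d) c, comp_prod (snd d) c)"

definition vmixed :: "series \<times> series \<Rightarrow> series \<times> series \<Rightarrow> series \<times> series" where
  "vmixed c d = (mixed_comp (fst c) d, mixed_comp (snd c) d)"

definition odot :: "series \<times> series \<Rightarrow> series \<times> series \<Rightarrow> series \<times> series" where
  "odot c d = (fst c \<amalg> fst d, snd c + (snd d \<amalg> fst c))"

definition star :: "series \<times> series \<Rightarrow> series \<times> series \<Rightarrow> series \<times> series" where
  "star c d = odot (vmixed c d) d"

definition odot_group :: "(series \<times> series) monoid" where
  "odot_group = \<lparr>carrier = G, mult = odot, one = (sone, 0)\<rparr>"

definition star_group :: "(series \<times> series) monoid" where
  "star_group = \<lparr>carrier = G, mult = star, one = (sone, 0)\<rparr>"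

definition feedback :: "series \<Rightarrow> series \<times> series \<Rightarrow> series"  (infixl "\<^bold>@" 65) where
  "c \<^bold>@ d = mixed_comp c (inv\<^bsub>star_group\<^esub> (vcomp (inv\<^bsub>odot_group\<^esub> d) c))"

lemma coproduct_length:
  "(u, v) \<in> set (coproduct w) \<Longrightarrow> length u + length v = length w"
  by (induction w arbitrary: u v) auto

lemma shuffle_order:
  assumes "\<And>w. length w < m \<Longrightarrow> c w = 0" and "\<And>w. length w < n \<Longrightarrow> d w = 0"
    and "length w < m + n"
  shows "(c \<amalg> d) w = 0"
proof -
  have "c u * d v = 0" if "(u, v) \<in> set (coproduct w)" for u v
  proof -
    have "length u < m \<or> length v < n"
      using coproduct_length[OF that] assms(3) by linarith
    then show ?thesis using assms(1,2) by auto
  qed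
  then have "map (\<lambda>(u, v). c u * d v) (coproduct w) = map (\<lambda>_. 0) (coproduct w)"
    by (intro map_cong) auto
  then show ?thesis unfolding shuffle_def by (simp only: sum_list_0)
qed

lemma lcons_order:
  assumes "\<And>w. length w < n \<Longrightarrow> c w = 0" and "length w < Suc n"
  shows "lcons x c w = 0"
  using assms by (cases w) auto

lemma shuffle_pow_order:
  assumes "c [] = 0" and "length w < k"
  shows "shuffle_pow c k w = 0"
  using assms(2)
proof (induction k arbitrary: w)
  case (Suc k)
  have "(c \<amalg> shuffle_pow c k) w = 0"
    by (rule shuffle_order[of 1 _ k]) (use Suc assms(1) in auto)
  then show ?case by (simp add: shuffle_pow_def)
qed simp

lemma comp_word_order: "length w < length \<eta> \<Longrightarrow> comp_word \<eta> d w = 0"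
proof (induction \<eta> arbitrary: w)
  case (Cons x \<eta>)
  have "(d \<amalg> comp_word \<eta> d) v = 0" if "length v < length \<eta>" for v
    by (rule shuffle_order[of 0 _ "length \<eta>"]) (use Cons.IH that in auto)
  with Cons show ?case
    by (auto split: letter.split intro!: lcons_order[where n = "length \<eta>"])
qed simp

lemma mixed_word_order: "length w < length \<eta> \<Longrightarrow> mixed_word \<eta> d w = 0"
proof (induction \<eta> arbitrary: w)
  case (Cons x \<eta>)
  have sh: "(e \<amalg> mixed_word \<eta> d) v = 0" if "length v < length \<eta>" for e v
    by (rule shuffle_order[of 0 _ "length \<eta>"]) (use Cons.IH that in auto)
  have "lcons y (e \<amalg> mixed_word \<eta> d) w = 0" for y e
    by (rule lcons_order[where n = "length \<eta>"]) (use sh Cons.prems in auto)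
  moreover have "lcons y (mixed_word \<eta> d) w = 0" for y
    by (rule lcons_order[where n = "length \<eta>"]) (use Cons in auto)
  ultimately show ?case
    by (auto split: letter.split)
qed simp

lemma finite_words_le: "finite {\<eta> :: letter list. length \<eta> \<le> n}"
proof -
  have "(UNIV :: letter set) = {X0, X1}"
    using letter.exhaust by auto
  then have "finite (UNIV :: letter set)"
    by (metis finite.emptyI finite.insertI)
  from finite_lists_length_le[OF this, of n] show ?thesis by simp
qed

lemma shuffle_inv_locally_finite:
  assumes "c [] = 1"
  shows "finite {k. shuffle_pow (sone - c) k w \<noteq> 0}"
proof (rule finite_subset)
  have "(sone - c) [] = 0"
    using assms by (simp add: sone_def)
  from shuffle_pow_order[where c = "sone - c", OF this] show "{k. shuffle_pow (sone - c) k w \<noteq> 0} \<subseteq> {..length w}"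
    by (metis (mono_tags, lifting) atMost_iff mem_Collect_eq not_le subsetI)
qed simp

lemma comp_prod_locally_finite: "finite {\<eta>. c \<eta> * comp_word \<eta> d w \<noteq> 0}"
  by (rule finite_subset[OF _ finite_words_le[of "length w"]])
    (auto intro: leI dest: comp_word_order)

lemma mixed_comp_locally_finite: "finite {\<eta>. c \<eta> * mixed_word \<eta> d w \<noteq> 0}"
  by (rule finite_subset[OF _ finite_words_le[of "length w"]])
    (auto intro: leI dest: mixed_word_order)

end

theory Submission
  imports Defs
begin

text \<open>
  Reading a series as the input-output operator \<open>u \<mapsto> F\<^sub>c(u)\<close>, the series \<open>y = c \<^bold>@ d\<close>
  describes the output of the system \<open>c\<close> whose input is \<open>d\<^sub>1(y) v + d\<^sub>2(y)\<close>, where \<open>v\<close> is the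
  external input.  Algebraically, \<open>y\<close> is the unique solution of the fixed point equation
  \<open>y = mixed_comp c (vcomp d y)\<close> (lemmas \<open>feedback_equation\<close> and \<open>feedback_unique\<close>); uniqueness
  holds because the coefficients of length \<open>n\<close> on the right depend only on those of \<open>y\<close> of length
  less than \<open>n\<close>.  Substituting one such equation into another shows that feedback is a right
  action of \<open>(G, \<odot>)\<close> on series,
  \<open>(c \<^bold>@ d) \<^bold>@ e = c \<^bold>@ (d \<odot> e)\<close>, with \<open>\<odot>\<close> for \<open>odot\<close> and \<open>\<star>\<close> for \<open>star\<close>
  (theorem \<open>feedback_odot\<close>).  The claim is then the computation of a product of four elements of this group:
  \<open>(1, d\<^sub>2) \<odot> (d\<^sub>1, 0) \<odot> (1, - d\<^sub>2) \<odot> (d\<^sub>1\<^sup>-\<^sup>1, 0) = (1, d\<^sub>2 - d\<^sub>2 \<amalg> d\<^sub>1)\<close>.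

  The substitution rests on four identities: both compositions are shuffle homomorphisms in
  their first argument, \<open>(a \<circ> b) \<circ>' d = a \<circ> (b \<circ>' d)\<close>, and \<open>(c \<circ>' d) \<circ>' e = c \<circ>' (d \<star> e)\<close>,
  where \<open>\<circ>'\<close> is the mixed composition.  They, like the commutativity and associativity of the
  shuffle product, are proved by one induction scheme: two series are equal if they have the same
  constant coefficient and the same left derivatives (deletion of a first letter).  The
  derivative is a derivation of the shuffle product and satisfies simple recursions on the two
  compositions, which turn each identity for words of length \<open>n + 1\<close> into instances of itself for
  words of length \<open>n\<close>.
\<close>

section \<open>Agreement of series up to a given length\<close>

text \<open>\<open>agree n f g\<close>: the coefficients of \<open>f\<close> and \<open>g\<close> coincide on all words of length strictly
  less than \<open>n\<close>.  In the corresponding ultrametric, a map that raises \<open>agree n\<close> to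
  \<open>agree (Suc n)\<close> is a contraction.\<close>
definition agree :: "nat \<Rightarrow> series \<Rightarrow> series \<Rightarrow> bool" where
  "agree n f g \<longleftrightarrow> (\<forall>w. length w < n \<longrightarrow> f w = g w)"

text \<open>The left derivative of \<open>c\<close> by the letter \<open>x\<close>, the adjoint of \<open>lcons x\<close>.\<close>
definition deriv :: "letter \<Rightarrow> series \<Rightarrow> series" where
  "deriv x c = (\<lambda>w. c (x # w))"

lemma agree_refl [simp]: "agree n f f"
  by (simp add: agree_def)

lemma agree_0 [simp]: "agree 0 f g"
  by (simp add: agree_def)

lemma agree_mono: "agree n f g \<Longrightarrow> m \<le> n \<Longrightarrow> agree m f g"
  by (simp add: agree_def)

lemma agree_add: "agree n f f' \<Longrightarrow> agree n g g' \<Longrightarrow> agree n (f + g) (f' + g')"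
  by (simp add: agree_def)

lemma agree_diff: "agree n f f' \<Longrightarrow> agree n g g' \<Longrightarrow> agree n (f - g) (f' - g')"
  by (simp add: agree_def)

lemma agree_SucI:
  assumes "f [] = g []" and "\<And>x. agree n (deriv x f) (deriv x g)"
  shows "agree (Suc n) f g"
  unfolding agree_def
proof (intro allI impI)
  fix w :: "letter list"
  assume "length w < Suc n"
  with assms show "f w = g w"
    by (cases w) (auto simp: agree_def deriv_def)
qed

lemma series_eqI: "(\<And>n. agree n f g) \<Longrightarrow> f = g"
  by (rule ext) (use lessI in \<open>auto simp: agree_def\<close>)

lemma deriv_add [simp]: "deriv x (c + d) = deriv x c + deriv x d"
  by (rule ext) (simp add: deriv_def)

lemma deriv_sone [simp]: "deriv x sone = 0"
  by (rule ext) (simp add: deriv_def sone_def)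

lemma sone_Nil [simp]: "sone [] = 1"
  by (simp add: sone_def)

section \<open>The shuffle algebra\<close>

lemma shuffle_Nil [simp]: "(c \<amalg> d) [] = c [] * d []"
  by (simp add: shuffle_def)

lemma deriv_shuffle [simp]: "deriv x (c \<amalg> d) = deriv x c \<amalg> d + c \<amalg> deriv x d"
  by (rule ext) (simp add: deriv_def shuffle_def o_def case_prod_unfold)

lemma shuffle_add_left: "(a + b) \<amalg> c = a \<amalg> c + b \<amalg> c"
  by (rule ext) (simp add: shuffle_def case_prod_unfold distrib_right sum_list_addf)

lemma shuffle_add_right: "c \<amalg> (a + b) = c \<amalg> a + c \<amalg> b"
  by (rule ext) (simp add: shuffle_def case_prod_unfold distrib_left sum_list_addf)

lemma shuffle_zero_left [simp]: "0 \<amalg> c = 0"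
  using shuffle_add_left[of 0 0 c] by simp

lemma shuffle_zero_right [simp]: "c \<amalg> 0 = 0"
  using shuffle_add_right[of c 0 0] by simp

lemma shuffle_uminus_left: "(- a) \<amalg> c = - (a \<amalg> c)"
  using shuffle_add_left[of a "- a" c] by (simp add: eq_neg_iff_add_eq_0 add.commute)

lemma shuffle_diff_left: "(a - b) \<amalg> c = a \<amalg> c - b \<amalg> c"
  using shuffle_add_left[of "a - b" b c] by (simp add: algebra_simps)

lemma shuffle_diff_right: "c \<amalg> (a - b) = c \<amalg> a - c \<amalg> b"
  using shuffle_add_right[of c "a - b" b] by (simp add: algebra_simps)

lemma shuffle_scale_right: "c \<amalg> (\<lambda>w. k * a w) = (\<lambda>w. k * (c \<amalg> a) w)"
  by (rule ext) (simp add: shuffle_def case_prod_unfold sum_list_const_mult mult.left_commute)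

lemma shuffle_sum_right:
  assumes "finite A"
  shows "c \<amalg> (\<lambda>w. \<Sum>i\<in>A. k i * f i w) = (\<lambda>w. \<Sum>i\<in>A. k i * (c \<amalg> f i) w)"
  using assms
proof (induction A)
  case empty
  then show ?case using shuffle_zero_right[of c] by (simp add: zero_fun_def)
next
  case (insert i A)
  have "(\<lambda>w. \<Sum>j\<in>insert i A. k j * f j w)
      = (\<lambda>w. k i * f i w) + (\<lambda>w. \<Sum>j\<in>A. k j * f j w)"
    using insert.hyps by (simp add: plus_fun_def)
  then have "c \<amalg> (\<lambda>w. \<Sum>j\<in>insert i A. k j * f j w)
      = (\<lambda>w. k i * (c \<amalg> f i) w) + (\<lambda>w. \<Sum>j\<in>A. k j * (c \<amalg> f j) w)"
    by (simp only: shuffle_add_right shuffle_scale_right insert.IH)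
  also have "\<dots> = (\<lambda>w. \<Sum>j\<in>insert i A. k j * (c \<amalg> f j) w)"
    using insert.hyps by (simp add: plus_fun_def)
  finally show ?case .
qed

lemma shuffle_commute: "a \<amalg> b = b \<amalg> a"
proof (rule series_eqI)
  show "agree n (a \<amalg> b) (b \<amalg> a)" for n
  proof (induction n arbitrary: a b)
    case (Suc n)
    show ?case
    proof (rule agree_SucI)
      fix x
      have "agree n (deriv x a \<amalg> b + a \<amalg> deriv x b) (b \<amalg> deriv x a + deriv x b \<amalg> a)"
        by (intro agree_add Suc)
      then show "agree n (deriv x (a \<amalg> b)) (deriv x (b \<amalg> a))"
        by (simp add: add.commute)
    qed simp
  qed simp
qed

lemma shuffle_assoc: "(a \<amalg> b) \<amalg> c = a \<amalg> (b \<amalg> c)"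
proof (rule series_eqI)
  show "agree n ((a \<amalg> b) \<amalg> c) (a \<amalg> (b \<amalg> c))" for n
  proof (induction n arbitrary: a b c)
    case (Suc n)
    show ?case
    proof (rule agree_SucI)
      fix x
      have "agree n ((deriv x a \<amalg> b) \<amalg> c + (a \<amalg> deriv x b) \<amalg> c + (a \<amalg> b) \<amalg> deriv x c)
        (deriv x a \<amalg> (b \<amalg> c) + a \<amalg> (deriv x b \<amalg> c) + a \<amalg> (b \<amalg> deriv x c))"
        by (intro agree_add Suc)
      then show "agree n (deriv x ((a \<amalg> b) \<amalg> c)) (deriv x (a \<amalg> (b \<amalg> c)))"
        by (simp add: shuffle_add_left shuffle_add_right add.assoc)
    qed simp
  qed simp
qed

lemma shuffle_left_commute: "a \<amalg> (b \<amalg> c) = b \<amalg> (a \<amalg> c)"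
  by (metis shuffle_assoc shuffle_commute)

lemma shuffle_sone_left [simp]: "sone \<amalg> c = c"
proof (rule series_eqI)
  show "agree n (sone \<amalg> c) c" for n
    by (induction n arbitrary: c) (auto intro: agree_SucI)
qed

lemma shuffle_sone_right [simp]: "c \<amalg> sone = c"
  by (metis shuffle_commute shuffle_sone_left)

lemma agree_shuffle_right: "agree n b b' \<Longrightarrow> agree n (a \<amalg> b) (a \<amalg> b')"
  using shuffle_order[of 0 a n "b - b'"]
  by (auto simp: agree_def shuffle_diff_right)

lemma agree_shuffle:
  "agree n a a' \<Longrightarrow> agree n b b' \<Longrightarrow> agree n (a \<amalg> b) (a' \<amalg> b')"
  using agree_shuffle_right[of n b b' a] agree_shuffle_right[of n a a' b']
  by (simp add: agree_def shuffle_commute)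

text \<open>A factor without constant coefficient gains one order of agreement, which makes
  \<open>b \<mapsto> a \<amalg> b\<close> a contraction.\<close>
lemma agree_Suc_shuffle:
  assumes "agree (Suc n) a a'" and "agree n b b'" and "a [] = 0"
  shows "agree (Suc n) (a \<amalg> b) (a' \<amalg> b')"
proof -
  have "agree (Suc n) (a \<amalg> b) (a \<amalg> b')"
    using shuffle_order[of 1 a n "b - b'"] assms(2,3)
    by (auto simp: agree_def shuffle_diff_right)
  moreover have "agree (Suc n) (a \<amalg> b') (a' \<amalg> b')"
    by (intro agree_shuffle assms agree_refl)
  ultimately show ?thesis by (simp add: agree_def)
qed

lemma shuffle_pow_Suc: "shuffle_pow c (Suc k) = c \<amalg> shuffle_pow c k"
  by (simp add: shuffle_pow_def)

lemma shuffle_inverse_right: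
  assumes "c [] = 1"
  shows "c \<amalg> shuffle_inv c = sone"
proof (rule series_eqI)
  \<comment> \<open>Below length \<open>n\<close> the inverse is the sum of the first \<open>N\<close> shuffle powers, for any \<open>N \<ge> n\<close>;
    multiplying such a partial sum by \<open>sone - c\<close> shifts it by one term.  The factor 1 in \<open>S\<close> matches the
    shape of \<open>shuffle_sum_right\<close>.\<close>
  fix n
  define p where "p = shuffle_pow (sone - c)"
  define S where "S N w = (\<Sum>k<N. 1 * p k w)" for N w
  have 0: "p k w = 0" if "length w < k" for k w
    unfolding p_def by (rule shuffle_pow_order) (use assms that in auto)
  have inv: "agree n (shuffle_inv c) (S N)" if "n \<le> N" for N
    unfolding agree_def
  proof (intro allI impI)
    fix w :: "letter list"
    assume w: "length w < n"
    have "k < N" if "p k w \<noteq> 0" for k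
      using 0[of w k] w that \<open>n \<le> N\<close> by (cases "length w < k") simp_all
    then have "{k. p k w \<noteq> 0} \<subseteq> {..<N}" by auto
    then have "shuffle_inv c w = (\<Sum>k<N. p k w)"
      unfolding shuffle_inv_def p_def[symmetric]
      by (intro Sum_any.expand_superset finite_lessThan)
    then show "shuffle_inv c w = S N w" by (simp add: S_def)
  qed
  have "(sone - c) \<amalg> S n + sone = S (Suc n)"
  proof (rule ext)
    fix w
    have "((sone - c) \<amalg> S n) w = (\<Sum>k<n. p (Suc k) w)"
      unfolding S_def by (subst shuffle_sum_right) (simp_all add: p_def shuffle_pow_Suc)
    then show "((sone - c) \<amalg> S n + sone) w = S (Suc n) w"
      unfolding S_def by (subst sum.lessThan_Suc_shift) (simp add: p_def shuffle_pow_def)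
  qed
  moreover have "agree n ((sone - c) \<amalg> shuffle_inv c + sone) ((sone - c) \<amalg> S n + sone)"
    by (intro agree_add agree_shuffle inv) auto
  ultimately have "agree n ((sone - c) \<amalg> shuffle_inv c + sone) (shuffle_inv c)"
    using inv[of "Suc n"] by (simp add: agree_def)
  then show "agree n (c \<amalg> shuffle_inv c) sone"
    by (auto simp: agree_def shuffle_diff_left)
qed

section \<open>Locally finite sums over words\<close>

text \<open>The linear extension to series of a map \<open>M\<close> on words.  Both compositions have this form,
  with \<open>M \<eta>\<close> vanishing on words shorter than \<open>\<eta>\<close>; under that assumption every coefficient is a
  sum over the words of bounded length.\<close>
definition word_sum :: "(letter list \<Rightarrow> series) \<Rightarrow> series \<Rightarrow> series" where
  "word_sum M c = (\<lambda>w. Sum_any (\<lambda>\<eta>. c \<eta> * M \<eta> w))"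

lemma word_sum_eq_sum:
  assumes "\<And>\<eta> w. length w < length \<eta> \<Longrightarrow> M \<eta> w = 0" and "length w \<le> n"
  shows "word_sum M c w = (\<Sum>\<eta> | length \<eta> \<le> n. c \<eta> * M \<eta> w)"
  unfolding word_sum_def
proof (rule Sum_any.expand_superset[OF finite_words_le])
  show "{\<eta>. c \<eta> * M \<eta> w \<noteq> 0} \<subseteq> {\<eta>. length \<eta> \<le> n}"
    using assms by (auto intro: leI order_trans)
qed

lemma words_le_Suc:
  "{\<eta> :: letter list. length \<eta> \<le> Suc n}
   = insert [] (Cons X0 ` {\<eta>. length \<eta> \<le> n} \<union> Cons X1 ` {\<eta>. length \<eta> \<le> n})"
proof -
  have "\<eta> \<in> insert [] (Cons X0 ` {\<eta>. length \<eta> \<le> n} \<union> Cons X1 ` {\<eta>. length \<eta> \<le> n})"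
    if "length \<eta> \<le> Suc n" for \<eta> :: "letter list"
    using that by (cases \<eta>; cases "hd \<eta>") auto
  then show ?thesis by auto
qed

lemma sum_words_le_Suc:
  fixes f :: "letter list \<Rightarrow> real"
  shows "(\<Sum>\<eta> | length \<eta> \<le> Suc n. f \<eta>)
   = f [] + (\<Sum>\<eta> | length \<eta> \<le> n. f (X0 # \<eta>)) + (\<Sum>\<eta> | length \<eta> \<le> n. f (X1 # \<eta>))"
proof -
  have "(\<Sum>\<eta> | length \<eta> \<le> Suc n. f \<eta>)
      = f [] + sum f (Cons X0 ` {\<eta>. length \<eta> \<le> n} \<union> Cons X1 ` {\<eta>. length \<eta> \<le> n})"
    unfolding words_le_Suc by (subst sum.insert) (auto simp: finite_words_le)
  also have "\<dots> = f [] + (sum f (Cons X0 ` {\<eta>. length \<eta> \<le> n})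
      + sum f (Cons X1 ` {\<eta>. length \<eta> \<le> n}))"
    by (subst sum.union_disjoint) (auto simp: finite_words_le)
  finally show ?thesis
    by (simp add: sum.reindex)
qed

lemma shuffle_word_sum:
  assumes "\<And>\<eta> w. length w < length \<eta> \<Longrightarrow> M \<eta> w = 0" and "length w \<le> n"
  shows "(d \<amalg> word_sum M c) w = (\<Sum>\<eta> | length \<eta> \<le> n. c \<eta> * (d \<amalg> M \<eta>) w)"
proof -
  have "agree (Suc n) (word_sum M c) (\<lambda>w. \<Sum>\<eta> | length \<eta> \<le> n. c \<eta> * M \<eta> w)"
    unfolding agree_def by (intro allI impI word_sum_eq_sum assms(1)) auto
  from agree_shuffle_right[OF this, of d] show ?thesis
    using assms(2) by (simp add: agree_def shuffle_sum_right[OF finite_words_le])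
qed

lemma word_sum_add:
  assumes "\<And>\<eta> w. length w < length \<eta> \<Longrightarrow> M \<eta> w = 0"
  shows "word_sum M (a + b) = word_sum M a + word_sum M b"
  by (rule ext)
    (simp add: word_sum_eq_sum[OF assms order_refl] distrib_right sum.distrib)

section \<open>The composition products\<close>

lemma comp_prod_word_sum: "comp_prod c d = word_sum (\<lambda>\<eta>. comp_word \<eta> d) c"
  by (simp add: comp_prod_def word_sum_def)

lemma mixed_comp_word_sum: "mixed_comp c d = word_sum (\<lambda>\<eta>. mixed_word \<eta> d) c"
  by (simp add: mixed_comp_def word_sum_def)

lemma comp_prod_add: "comp_prod (a + b) d = comp_prod a d + comp_prod b d"
  unfolding comp_prod_word_sum by (rule word_sum_add) (rule comp_word_order)

lemma mixed_comp_add: "mixed_comp (a + b) d = mixed_comp a d + mixed_comp b d"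
  unfolding mixed_comp_word_sum by (rule word_sum_add) (rule mixed_word_order)

lemma comp_prod_zero [simp]: "comp_prod 0 d = 0"
  by (simp add: comp_prod_def zero_fun_def)

lemma mixed_comp_zero [simp]: "mixed_comp 0 d = 0"
  by (simp add: mixed_comp_def zero_fun_def)

lemma comp_prod_Nil [simp]: "comp_prod c d [] = c []"
  by (simp add: comp_prod_word_sum word_sum_eq_sum[OF comp_word_order, where n = 0])

lemma mixed_comp_Nil [simp]: "mixed_comp c d [] = c []"
  by (simp add: mixed_comp_word_sum word_sum_eq_sum[OF mixed_word_order, where n = 0])

text \<open>The recursions defining the compositions on words, transposed to series.\<close>
lemma deriv_comp_prod:
  "deriv x (comp_prod c d)
   = (case x of X0 \<Rightarrow> comp_prod (deriv X0 c) d + d \<amalg> comp_prod (deriv X1 c) d | X1 \<Rightarrow> 0)"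
proof (rule ext)
  fix w :: "letter list"
  let ?S = "{\<eta> :: letter list. length \<eta> \<le> length w}"
  have "deriv x (comp_prod c d) w
      = (\<Sum>\<eta> | length \<eta> \<le> Suc (length w). c \<eta> * comp_word \<eta> d (x # w))"
    unfolding deriv_def comp_prod_word_sum
    by (rule word_sum_eq_sum[OF comp_word_order]) auto
  also have "\<dots> = (\<Sum>\<eta>\<in>?S. c (X0 # \<eta>) * comp_word (X0 # \<eta>) d (x # w))
      + (\<Sum>\<eta>\<in>?S. c (X1 # \<eta>) * comp_word (X1 # \<eta>) d (x # w))"
    unfolding sum_words_le_Suc by (simp add: sone_def)
  also have "\<dots> = (case x of X0 \<Rightarrow> comp_prod (deriv X0 c) d + d \<amalg> comp_prod (deriv X1 c) d
      | X1 \<Rightarrow> 0) w"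
    unfolding comp_prod_word_sum
    by (cases x) (auto simp: shuffle_word_sum[OF comp_word_order order_refl]
      word_sum_eq_sum[OF comp_word_order order_refl] deriv_def)
  finally show "deriv x (comp_prod c d) w = \<dots>" .
qed

lemma deriv_mixed_comp:
  "deriv x (mixed_comp c d)
   = (case x of X0 \<Rightarrow> mixed_comp (deriv X0 c) d + snd d \<amalg> mixed_comp (deriv X1 c) d
      | X1 \<Rightarrow> fst d \<amalg> mixed_comp (deriv X1 c) d)"
proof (rule ext)
  fix w :: "letter list"
  let ?S = "{\<eta> :: letter list. length \<eta> \<le> length w}"
  have "deriv x (mixed_comp c d) w
      = (\<Sum>\<eta> | length \<eta> \<le> Suc (length w). c \<eta> * mixed_word \<eta> d (x # w))"
    unfolding deriv_def mixed_comp_word_sum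
    by (rule word_sum_eq_sum[OF mixed_word_order]) auto
  also have "\<dots> = (\<Sum>\<eta>\<in>?S. c (X0 # \<eta>) * mixed_word (X0 # \<eta>) d (x # w))
      + (\<Sum>\<eta>\<in>?S. c (X1 # \<eta>) * mixed_word (X1 # \<eta>) d (x # w))"
    unfolding sum_words_le_Suc by (simp add: sone_def)
  also have "\<dots> = (case x of
        X0 \<Rightarrow> mixed_comp (deriv X0 c) d + snd d \<amalg> mixed_comp (deriv X1 c) d
      | X1 \<Rightarrow> fst d \<amalg> mixed_comp (deriv X1 c) d) w"
    unfolding mixed_comp_word_sum
    by (cases x) (auto simp: shuffle_word_sum[OF mixed_word_order order_refl]
      word_sum_eq_sum[OF mixed_word_order order_refl] deriv_def)
  finally show "deriv x (mixed_comp c d) w = \<dots>" .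
qed

lemma comp_prod_sone [simp]: "comp_prod sone d = sone"
proof (rule series_eqI)
  show "agree n (comp_prod sone d) sone" for n
    by (cases n) (auto intro!: agree_SucI simp: deriv_comp_prod split: letter.split)
qed

lemma mixed_comp_sone [simp]: "mixed_comp sone d = sone"
proof (rule series_eqI)
  show "agree n (mixed_comp sone d) sone" for n
    by (cases n) (auto intro!: agree_SucI simp: deriv_mixed_comp split: letter.split)
qed

lemma mixed_comp_identity [simp]: "mixed_comp c (sone, 0) = c"
proof (rule series_eqI)
  show "agree n (mixed_comp c (sone, 0)) c" for n
    by (induction n arbitrary: c)
      (auto intro!: agree_SucI simp: deriv_mixed_comp split: letter.split)
qed

lemma comp_prod_shuffle: "comp_prod (a \<amalg> b) d = comp_prod a d \<amalg> comp_prod b d"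
proof (rule series_eqI)
  show "agree n (comp_prod (a \<amalg> b) d) (comp_prod a d \<amalg> comp_prod b d)" for n
  proof (induction n arbitrary: a b)
    case (Suc n)
    let ?C = "\<lambda>a. comp_prod a d"
    have 0: "agree n
        ((?C (deriv X0 a \<amalg> b) + ?C (a \<amalg> deriv X0 b))
          + d \<amalg> (?C (deriv X1 a \<amalg> b) + ?C (a \<amalg> deriv X1 b)))
        ((?C (deriv X0 a) \<amalg> ?C b + ?C a \<amalg> ?C (deriv X0 b))
          + d \<amalg> (?C (deriv X1 a) \<amalg> ?C b + ?C a \<amalg> ?C (deriv X1 b)))"
      by (intro agree_add agree_shuffle agree_refl Suc)
    show ?case
    proof (rule agree_SucI)
      show "agree n (deriv x (?C (a \<amalg> b))) (deriv x (?C a \<amalg> ?C b))" for x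
        using 0 by (cases x) (simp_all add: deriv_comp_prod comp_prod_add shuffle_add_left
            shuffle_add_right shuffle_assoc shuffle_left_commute[of _ d] add_ac)
    qed simp
  qed simp
qed

lemma mixed_comp_shuffle: "mixed_comp (a \<amalg> b) d = mixed_comp a d \<amalg> mixed_comp b d"
proof (rule series_eqI)
  show "agree n (mixed_comp (a \<amalg> b) d) (mixed_comp a d \<amalg> mixed_comp b d)" for n
  proof (induction n arbitrary: a b)
    case (Suc n)
    let ?C = "\<lambda>a. mixed_comp a d"
    have 1: "agree n (e \<amalg> (?C (deriv X1 a \<amalg> b) + ?C (a \<amalg> deriv X1 b)))
        (e \<amalg> (?C (deriv X1 a) \<amalg> ?C b + ?C a \<amalg> ?C (deriv X1 b)))" for e
      by (intro agree_add agree_shuffle agree_refl Suc)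
    have 0: "agree n
        ((?C (deriv X0 a \<amalg> b) + ?C (a \<amalg> deriv X0 b))
          + snd d \<amalg> (?C (deriv X1 a \<amalg> b) + ?C (a \<amalg> deriv X1 b)))
        ((?C (deriv X0 a) \<amalg> ?C b + ?C a \<amalg> ?C (deriv X0 b))
          + snd d \<amalg> (?C (deriv X1 a) \<amalg> ?C b + ?C a \<amalg> ?C (deriv X1 b)))"
      by (intro agree_add Suc 1)
    show ?case
    proof (rule agree_SucI)
      show "agree n (deriv x (?C (a \<amalg> b))) (deriv x (?C a \<amalg> ?C b))" for x
        using 0 1[of "fst d"]
        by (cases x) (simp_all add: deriv_mixed_comp mixed_comp_add shuffle_add_left
            shuffle_add_right shuffle_assoc shuffle_left_commute[of _ "fst d"]
            shuffle_left_commute[of _ "snd d"] add_ac)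
    qed simp
  qed simp
qed

lemma mixed_comp_comp_prod: "mixed_comp (comp_prod a b) d = comp_prod a (mixed_comp b d)"
proof (rule series_eqI)
  show "agree n (mixed_comp (comp_prod a b) d) (comp_prod a (mixed_comp b d))" for n
  proof (induction n arbitrary: a)
    case (Suc n)
    have 0: "agree n
        (mixed_comp (comp_prod (deriv X0 a) b) d
          + mixed_comp b d \<amalg> mixed_comp (comp_prod (deriv X1 a) b) d)
        (comp_prod (deriv X0 a) (mixed_comp b d)
          + mixed_comp b d \<amalg> comp_prod (deriv X1 a) (mixed_comp b d))"
      by (intro agree_add agree_shuffle agree_refl Suc)
    show ?case
    proof (rule agree_SucI)
      show "agree n (deriv x (mixed_comp (comp_prod a b) d))
          (deriv x (comp_prod a (mixed_comp b d)))" for x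
        using 0 by (cases x)
          (simp_all add: deriv_mixed_comp deriv_comp_prod mixed_comp_add mixed_comp_shuffle)
    qed simp
  qed simp
qed

lemma fst_star: "fst (star d e) = mixed_comp (fst d) e \<amalg> fst e"
  and snd_star: "snd (star d e) = mixed_comp (snd d) e + snd e \<amalg> mixed_comp (fst d) e"
  by (simp_all add: star_def odot_def vmixed_def)

lemma mixed_comp_mixed_comp: "mixed_comp (mixed_comp c d) e = mixed_comp c (star d e)"
proof (rule series_eqI)
  show "agree n (mixed_comp (mixed_comp c d) e) (mixed_comp c (star d e))" for n
  proof (induction n arbitrary: c)
    case (Suc n)
    have 1: "agree n (a \<amalg> mixed_comp (mixed_comp (deriv X1 c) d) e)
        (a \<amalg> mixed_comp (deriv X1 c) (star d e))" for a
      by (intro agree_shuffle agree_refl Suc)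
    have 0: "agree n (mixed_comp (mixed_comp (deriv X0 c) d) e
          + snd (star d e) \<amalg> mixed_comp (mixed_comp (deriv X1 c) d) e)
        (mixed_comp (deriv X0 c) (star d e)
          + snd (star d e) \<amalg> mixed_comp (deriv X1 c) (star d e))"
      by (intro agree_add Suc 1)
    show ?case
    proof (rule agree_SucI)
      show "agree n (deriv x (mixed_comp (mixed_comp c d) e))
          (deriv x (mixed_comp c (star d e)))" for x
      proof (cases x)
        case X0
        have "deriv X0 (mixed_comp (mixed_comp c d) e)
            = mixed_comp (mixed_comp (deriv X0 c) d) e
              + snd (star d e) \<amalg> mixed_comp (mixed_comp (deriv X1 c) d) e"
          by (simp add: deriv_mixed_comp snd_star mixed_comp_add mixed_comp_shuffle
              shuffle_add_left shuffle_assoc add_ac)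
        with 0 X0 show ?thesis by (simp add: deriv_mixed_comp[of X0 c])
      next
        case X1
        have "deriv X1 (mixed_comp (mixed_comp c d) e)
            = fst (star d e) \<amalg> mixed_comp (mixed_comp (deriv X1 c) d) e"
          by (simp add: deriv_mixed_comp fst_star mixed_comp_shuffle
              shuffle_assoc shuffle_left_commute)
        with 1 X1 show ?thesis by (simp add: deriv_mixed_comp[of X1 c])
      qed
    qed simp
  qed simp
qed

text \<open>Both compositions are strictly causal in their second argument: coefficients of length at
  most \<open>n\<close> only depend on coefficients of length less than \<open>n\<close> of that argument.\<close>

lemma agree_comp_prod:
  "agree n d d' \<Longrightarrow> agree (Suc n) (comp_prod c d) (comp_prod c d')"
proof (induction n arbitrary: c)
  case 0
  show ?case by (rule agree_SucI) auto
next
  case (Suc n)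
  then have d: "agree n d d'" by (simp add: agree_mono)
  show ?case
    by (rule agree_SucI)
      (auto simp: deriv_comp_prod split: letter.split
        intro!: agree_add agree_shuffle Suc.prems Suc.IH[OF d])
qed

lemma agree_mixed_comp:
  "agree n (fst d) (fst d') \<Longrightarrow> agree n (snd d) (snd d')
   \<Longrightarrow> agree (Suc n) (mixed_comp c d) (mixed_comp c d')"
proof (induction n arbitrary: c)
  case 0
  show ?case by (rule agree_SucI) auto
next
  case (Suc n)
  then have d: "agree n (fst d) (fst d')" "agree n (snd d) (snd d')"
    by (simp_all add: agree_mono)
  show ?case
    by (rule agree_SucI)
      (auto simp: deriv_mixed_comp split: letter.split
        intro!: agree_add agree_shuffle Suc.prems Suc.IH[OF d])
qed

section \<open>The two groups\<close>

lemma odot_assoc: "odot (odot a b) c = odot a (odot b c)"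
  by (simp add: odot_def shuffle_add_left add.assoc shuffle_assoc shuffle_commute[of "fst a"])

lemma group_odot: "group odot_group"
proof (rule groupI)
  fix c assume "c \<in> carrier odot_group"
  then have "fst c [] = 1" by (simp add: odot_group_def G_def)
  then have inv: "fst c \<amalg> shuffle_inv (fst c) = sone"
    by (rule shuffle_inverse_right)
  let ?y = "(shuffle_inv (fst c), - (snd c \<amalg> shuffle_inv (fst c)))"
  have "shuffle_inv (fst c) [] = 1"
    using arg_cong[OF inv, of "\<lambda>f. f []"] \<open>fst c [] = 1\<close> by simp
  then have "?y \<in> carrier odot_group" by (simp add: odot_group_def G_def)
  moreover have "odot ?y c = (sone, 0)"
    using inv by (simp add: odot_def shuffle_commute)
  ultimately show "\<exists>y\<in>carrier odot_group. y \<otimes>\<^bsub>odot_group\<^esub> c = \<one>\<^bsub>odot_group\<^esub>"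
    by (auto simp: odot_group_def)
qed (auto simp: odot_group_def G_def odot_assoc, auto simp: odot_def)

lemma star_assoc: "star (star a b) c = star a (star b c)"
  by (rule prod_eqI)
    (simp_all add: fst_star snd_star mixed_comp_add mixed_comp_shuffle mixed_comp_mixed_comp
      shuffle_assoc shuffle_add_left shuffle_add_right add.assoc
      shuffle_commute[of "mixed_comp (fst a) (star b c)"])

text \<open>The fixed point is the limit of the iterates of \<open>F\<close> from an arbitrary starting point: its
  coefficient at \<open>w\<close> is that of any iterate with index above the length of \<open>w\<close>.\<close>
lemma contraction_fixpoint:
  fixes F :: "series \<times> series \<Rightarrow> series \<times> series"
  assumes "\<And>n u v. agree n (fst u) (fst v) \<Longrightarrow> agree n (snd u) (snd v) \<Longrightarrow>
    agree (Suc n) (fst (F u)) (fst (F v)) \<and> agree (Suc n) (snd (F u)) (snd (F v))"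
  shows "\<exists>u. F u = u"
proof -
  define s where "s n = (F ^^ n) (0, 0)" for n
  have step: "agree n (fst (s n)) (fst (s (n + k))) \<and> agree n (snd (s n)) (snd (s (n + k)))"
    for n k
  proof (induction n)
    case (Suc n)
    from assms[OF conjunct1[OF Suc] conjunct2[OF Suc]] show ?case
      by (simp add: s_def)
  qed simp
  define u where "u = (\<lambda>w. fst (s (Suc (length w))) w, \<lambda>w. snd (s (Suc (length w))) w)"
  have u: "agree n (fst u) (fst (s n)) \<and> agree n (snd u) (snd (s n))" for n
    unfolding agree_def
  proof (intro conjI allI impI)
    fix w :: "letter list"
    assume "length w < n"
    then obtain k where "n = Suc (length w) + k"
      using less_imp_Suc_add by auto
    then show "fst u w = fst (s n) w" "snd u w = snd (s n) w"
      using step[of "Suc (length w)" k] by (auto simp: u_def agree_def)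
  qed
  have "agree n (fst (F u)) (fst u) \<and> agree n (snd (F u)) (snd u)" for n
  proof -
    have "agree (Suc n) (fst (F u)) (fst (s (Suc n))) \<and> agree (Suc n) (snd (F u)) (snd (s (Suc n)))"
      using assms[OF conjunct1[OF u[of n]] conjunct2[OF u[of n]]] by (simp add: s_def)
    with u[of "Suc n"] show ?thesis by (simp add: agree_def)
  qed
  then have "F u = u"
    by (auto intro!: prod_eqI series_eqI)
  then show ?thesis ..
qed

lemma star_right_inverse:
  assumes "c \<in> G"
  shows "\<exists>w\<in>G. star c w = (sone, 0)"
proof -
  \<comment> \<open>The two components of \<open>star c w = (sone, 0)\<close>, rearranged as \<open>w = F w\<close>.\<close>
  define F where "F w = (sone + (sone - mixed_comp (fst c) w) \<amalg> fst w,
    (sone - mixed_comp (fst c) w) \<amalg> snd w - mixed_comp (snd c) w)" for w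
  have c: "fst c [] = 1" using assms by (simp add: G_def)
  have "\<exists>w. F w = w"
  proof (rule contraction_fixpoint)
    fix n and u v :: "series \<times> series"
    assume "agree n (fst u) (fst v)" "agree n (snd u) (snd v)"
    then show "agree (Suc n) (fst (F u)) (fst (F v)) \<and> agree (Suc n) (snd (F u)) (snd (F v))"
      by (auto simp: F_def c intro!: agree_add agree_diff agree_Suc_shuffle agree_mixed_comp)
  qed
  then obtain w where w: "F w = w" ..
  have 1: "fst w = sone + (sone - mixed_comp (fst c) w) \<amalg> fst w"
    and 2: "snd w = (sone - mixed_comp (fst c) w) \<amalg> snd w - mixed_comp (snd c) w"
    using arg_cong[OF w, of fst] arg_cong[OF w, of snd] by (simp_all add: F_def)
  have "fst w [] = 1"
    using arg_cong[OF 1, of "\<lambda>f. f []"] c by simp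
  moreover have "star c w = (sone, 0)"
    using 1 2 by (intro prod_eqI) (simp_all add: fst_star snd_star shuffle_diff_left
        shuffle_commute[of "snd w"] algebra_simps)
  ultimately show ?thesis by (intro bexI[of _ w]) (simp_all add: G_def)
qed

lemma group_star: "group star_group"
proof (rule groupI)
  fix c assume "c \<in> carrier star_group"
  then obtain w where w: "w \<in> G" "star c w = (sone, 0)"
    using star_right_inverse[of c] by (auto simp: star_group_def)
  \<comment> \<open>The right inverse of \<open>w\<close> is \<open>c\<close> itself, so \<open>w\<close> is also a left inverse of \<open>c\<close>.\<close>
  then obtain v where v: "v \<in> G" "star w v = (sone, 0)"
    using star_right_inverse by blast
  have "v = star (star c w) v"
    by (rule prod_eqI) (simp_all add: w fst_star snd_star)
  also have "\<dots> = c"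
    unfolding star_assoc v by (rule prod_eqI) (simp_all add: fst_star snd_star)
  finally show "\<exists>y\<in>carrier star_group. y \<otimes>\<^bsub>star_group\<^esub> c = \<one>\<^bsub>star_group\<^esub>"
    using w v by (auto simp: star_group_def)
qed (simp_all add: star_group_def G_def star_assoc fst_star snd_star prod_eq_iff)

section \<open>The feedback product\<close>

lemma vcomp_in_G: "d \<in> G \<Longrightarrow> vcomp d c \<in> G"
  by (simp add: vcomp_def G_def)

lemma odot_in_G: "d \<in> G \<Longrightarrow> e \<in> G \<Longrightarrow> odot d e \<in> G"
  by (simp add: odot_def G_def)

lemma vcomp_odot: "vcomp (odot d e) c = odot (vcomp d c) (vcomp e c)"
  by (simp add: vcomp_def odot_def comp_prod_add comp_prod_shuffle)

lemma vmixed_vcomp: "vmixed (vcomp d c) e = vcomp d (mixed_comp c e)"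
  by (simp add: vmixed_def vcomp_def mixed_comp_comp_prod)

text \<open>Let \<open>D\<close> be the inverse of \<open>d\<close> for \<open>\<odot>\<close>, \<open>W\<close> the inverse of \<open>vcomp D c\<close> for \<open>\<star>\<close>, and
  \<open>y = c \<^bold>@ d\<close>.  By \<open>vmixed_vcomp\<close>, the defining equation of \<open>W\<close> says that
  \<open>W\<close> is inverse to \<open>vcomp D y\<close> in the group of \<open>\<odot>\<close>; so is \<open>vcomp d y\<close>, since \<open>D\<close> is inverse to
  \<open>d\<close>.\<close>
lemma feedback_equation:
  assumes d: "d \<in> G"
  shows "c \<^bold>@ d = mixed_comp c (vcomp d (c \<^bold>@ d))"
proof -
  interpret O: group odot_group by (rule group_odot)
  interpret S: group star_group by (rule group_star)
  define D where "D = inv\<^bsub>odot_group\<^esub> d"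
  define W where "W = inv\<^bsub>star_group\<^esub> (vcomp D c)"
  define y where "y = c \<^bold>@ d"
  have y: "y = mixed_comp c W"
    by (simp add: y_def feedback_def W_def D_def)
  have D: "D \<in> G" "odot D d = (sone, 0)"
    using O.inv_closed[of d] O.l_inv[of d] d by (simp_all add: D_def odot_group_def)
  have W: "W \<in> G" "star (vcomp D c) W = (sone, 0)"
    using S.inv_closed[of "vcomp D c"] S.r_inv[of "vcomp D c"] vcomp_in_G[OF D(1)]
    by (simp_all add: W_def star_group_def)
  have "odot (vcomp D y) W = (sone, 0)"
    using W(2) by (simp add: star_def vmixed_vcomp y)
  also have "\<dots> = odot (vcomp D y) (vcomp d y)"
    using vcomp_odot[of D d y] D(2) by (simp add: vcomp_def)
  finally have eq: "odot (vcomp D y) W = odot (vcomp D y) (vcomp d y)" .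
  have "W = vcomp d y"
    using O.inj_on_cmult[of "vcomp D y"] eq W(1) vcomp_in_G[OF D(1)] vcomp_in_G[OF d]
    by (simp add: odot_group_def inj_on_def)
  with y show ?thesis unfolding y_def by simp
qed

lemma feedback_unique:
  assumes "y = mixed_comp c (vcomp d y)" and "z = mixed_comp c (vcomp d z)"
  shows "y = z"
proof (rule series_eqI)
  show "agree n y z" for n
  proof (induction n)
    case (Suc n)
    have "agree (Suc n) (comp_prod a y) (comp_prod a z)" for a
      by (rule agree_comp_prod[OF Suc])
    then have "agree (Suc n) (mixed_comp c (vcomp d y)) (mixed_comp c (vcomp d z))"
      by (intro agree_mono[OF agree_mixed_comp, of "Suc n"]) (auto simp: vcomp_def)
    with assms show ?case by simp
  qed simp
qed

text \<open>Feedback is a right action of the group of \<open>\<odot>\<close>.\<close>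
theorem feedback_odot:
  assumes d: "d \<in> G" and e: "e \<in> G"
  shows "(c \<^bold>@ d) \<^bold>@ e = c \<^bold>@ odot d e"
proof (rule feedback_unique)
  define z where "z = c \<^bold>@ d"
  define y where "y = z \<^bold>@ e"
  have z: "z = mixed_comp c (vcomp d z)"
    unfolding z_def by (rule feedback_equation[OF d])
  have y: "y = mixed_comp z (vcomp e y)"
    unfolding y_def by (rule feedback_equation[OF e])
  have "y = mixed_comp (mixed_comp c (vcomp d z)) (vcomp e y)"
    using y z by simp
  also have "\<dots> = mixed_comp c (odot (vcomp d (mixed_comp z (vcomp e y))) (vcomp e y))"
    by (simp add: mixed_comp_mixed_comp star_def vmixed_vcomp)
  also have "\<dots> = mixed_comp c (vcomp (odot d e) y)"
    using y by (simp add: vcomp_odot)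
  finally show "(c \<^bold>@ d) \<^bold>@ e = mixed_comp c (vcomp (odot d e) ((c \<^bold>@ d) \<^bold>@ e))"
    by (simp add: y_def z_def)
  show "c \<^bold>@ odot d e = mixed_comp c (vcomp (odot d e) (c \<^bold>@ odot d e))"
    by (rule feedback_equation[OF odot_in_G[OF d e]])
qed

theorem mainTheorem5:
  fixes c d1 d2 :: series
  assumes "d1 [] = 1"
  shows "(((c \<^bold>@ (sone, d2)) \<^bold>@ (d1, 0)) \<^bold>@ (sone, - d2)) \<^bold>@ (shuffle_inv d1, 0)
         = c \<^bold>@ (sone, d2 \<amalg> (sone - d1))"
proof -
  have inv: "d1 \<amalg> shuffle_inv d1 = sone"
    by (rule shuffle_inverse_right) (rule assms)
  have "shuffle_inv d1 [] = 1"
    using arg_cong[OF inv, of "\<lambda>f. f []"] assms by simp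
  then have "(((c \<^bold>@ (sone, d2)) \<^bold>@ (d1, 0)) \<^bold>@ (sone, - d2)) \<^bold>@ (shuffle_inv d1, 0)
      = c \<^bold>@ odot (odot (odot (sone, d2) (d1, 0)) (sone, - d2)) (shuffle_inv d1, 0)"
    using assms by (simp add: feedback_odot odot_in_G G_def odot_def)
  also have "odot (odot (odot (sone, d2) (d1, 0)) (sone, - d2)) (shuffle_inv d1, 0)
      = (sone, d2 \<amalg> (sone - d1))"
    by (simp add: odot_def inv shuffle_diff_right shuffle_uminus_left)
  finally show ?thesis .
qed

end
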